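(* For complex $q$ with $|q|<1$ and nonzero complex $a$ such that no denominator below vanishes, $$ \sum_{k=0}^\infty\frac{(aq;q^2)_k (q/a;q^2)_k (q;q^2)_{2k}}{(q^2;q^2)_{2k}(aq^6;q^6)_k (q^6/a;q^6)_k }[8k+1]q^{2k^2} =\frac{(q^5;q^6)_\infty(q^7;q^6)_\infty(aq^3;q^6)_\infty(q^3/a;q^6)_\infty} {(q^2;q^6)_\infty(q^4;q^6)_\infty(aq^6;q^6)_\infty(q^6/a;q^6)_\infty}. $$
   Context: For $|q|<1$: $(x;q)_\infty=\prod_{j\ge0}(1-xq^j)$, $(x;q)_k=\prod_{j=0}^{k-1}(1-xq^j)$ for integers $k\ge0$, and $[n]=(1-q^n)/(1-q)$. *)

theory Defs
  imports "HOL-Analysis.Analysis"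
begin

definition qpoch :: "complex \<Rightarrow> complex \<Rightarrow> nat \<Rightarrow> complex" where
  "qpoch x q k = (\<Prod>j<k. 1 - x * q ^ j)"

definition qpoch_inf :: "complex \<Rightarrow> complex \<Rightarrow> complex" where
  "qpoch_inf x q = (\<Prod>j. 1 - x * q ^ j)"

definition qint :: "complex \<Rightarrow> nat \<Rightarrow> complex" where
  "qint q n = (1 - q ^ n) / (1 - q)"

end

theory Submission
  imports Defs
begin

text \<open>
  Put \<open>p = q\<^sup>2\<close>, \<open>b = a q\<close> and replace the quantity \<open>q\<close> in \<open>[8k+1] (q; q\<^sup>2)\<^bsub>2k\<^esub>\<close> by a free parameter \<open>A\<close>.
  After multiplication by \<open>(A b p\<^sup>2, A p\<^sup>3/b; p\<^sup>3)\<^sub>\<infinity>\<close> the sum \<open>S(A)\<close> satisfies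
  \<open>S(A) = (1 - A p\<^sup>2) (1 - A p\<^sup>3) S(A p\<^sup>3)\<close>, because the difference of the summands telescopes.
  Iterating and letting \<open>A p\<^bsup>3n\<^esup>\<close> tend to 0 gives \<open>S(A) = (A p\<^sup>2, A p\<^sup>3; p\<^sup>3)\<^sub>\<infinity> S(0)\<close>.
  At \<open>A = 1/p\<close> all summands except the first vanish, which determines \<open>S(0)\<close>.
\<close>

section \<open>Finite and infinite q-Pochhammer symbols: bounds, limits, non-vanishing\<close>

lemma qpoch_0 [simp]: "qpoch x q 0 = 1"
  by (simp add: qpoch_def)

lemma qpoch_Suc: "qpoch x q (Suc n) = qpoch x q n * (1 - x * q ^ n)"
  by (simp add: qpoch_def)

lemma qpoch_Suc_shift: "qpoch x q (Suc n) = (1 - x) * qpoch (x * q) q n"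
  by (simp add: qpoch_def prod.lessThan_Suc_shift mult.assoc del: prod.lessThan_Suc)

text \<open>Taking norms in the expanded product compares it with the product of
  \<open>1 + norm (x * q ^ j)\<close>, which is at most the exponential of a geometric series. The
  bound does not depend on \<open>n\<close> and tends to 0 with \<open>x\<close>: the former gives
  domination, the latter continuity at 0.\<close>

lemma norm_qpoch_minus_one_le:
  assumes "norm q < 1"
  shows "norm (qpoch x q n - 1) \<le> exp (norm x / (1 - norm q)) - 1"
proof -
  have "norm (qpoch x q n - 1) \<le> (\<Prod>j<n. 1 + norm (- x * q ^ j)) - 1"
    using norm_prod_minus1_le_prod_minus1[of "\<lambda>j. - x * q ^ j" "{..<n}"]
    by (simp add: qpoch_def)
  moreover have "(\<Prod>j<n. 1 + norm (- x * q ^ j)) \<le> exp (\<Sum>j<n. norm (- x * q ^ j))"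
    by (rule prod_le_exp_sum) auto
  moreover
  have "(\<Sum>j<n. norm (- x * q ^ j)) \<le> norm x / (1 - norm q)"
  proof -
    have "(\<Sum>j<n. norm q ^ j) \<le> (\<Sum>j. norm q ^ j)"
      using assms by (intro sum_le_suminf) (auto intro: summable_geometric)
    then have "(\<Sum>j<n. norm q ^ j) \<le> 1 / (1 - norm q)"
      using assms by (simp add: suminf_geometric)
    from mult_left_mono[OF this, of "norm x"] show ?thesis
      by (simp add: norm_mult norm_power sum_distrib_left)
  qed
  then have "exp (\<Sum>j<n. norm (- x * q ^ j)) \<le> exp (norm x / (1 - norm q))"
    by (simp only: exp_le_cancel_iff)
  ultimately show ?thesis
    by linarith
qed

lemma norm_qpoch_le:
  assumes "norm q < 1"
  shows "norm (qpoch x q n) \<le> exp (norm x / (1 - norm q))"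
  using norm_qpoch_minus_one_le[OF assms, of x n] norm_triangle_ineq2[of "qpoch x q n" 1] by simp

lemma convergent_prod_qpoch:
  fixes x q :: complex
  assumes "norm q < 1"
  shows "convergent_prod (\<lambda>j. 1 - x * q ^ j)"
proof (rule abs_convergent_prod_imp_convergent_prod)
  have "summable (\<lambda>j. norm x * norm q ^ j)"
    using assms by (intro summable_mult summable_geometric) auto
  then show "abs_convergent_prod (\<lambda>j. 1 - x * q ^ j)"
    unfolding abs_convergent_prod_conv_summable by (simp add: norm_mult norm_power)
qed

lemma qpoch_tendsto:
  assumes "norm q < 1"
  shows "(\<lambda>n. qpoch x q n) \<longlonglongrightarrow> qpoch_inf x q"
  using convergent_prod_LIMSEQ[OF convergent_prod_qpoch[OF assms, of x]]
  unfolding qpoch_def qpoch_inf_def LIMSEQ_lessThan_iff_atMost .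

lemma norm_qpoch_inf_minus_one_le:
  assumes "norm q < 1"
  shows "norm (qpoch_inf x q - 1) \<le> exp (norm x / (1 - norm q)) - 1"
  by (rule Lim_norm_ubound[OF _ tendsto_diff[OF qpoch_tendsto[OF assms] tendsto_const]])
     (auto intro: always_eventually norm_qpoch_minus_one_le[OF assms])

lemma norm_qpoch_inf_le:
  assumes "norm q < 1"
  shows "norm (qpoch_inf x q) \<le> exp (norm x / (1 - norm q))"
  using norm_qpoch_inf_minus_one_le[OF assms, of x] norm_triangle_ineq2[of "qpoch_inf x q" 1] by simp

lemma qpoch_inf_0 [simp]: "qpoch_inf 0 q = 1"
  by (simp add: qpoch_inf_def)

lemma qpoch_inf_tendsto_one:
  assumes "norm q < 1" and "(f \<longlongrightarrow> 0) F"
  shows "((\<lambda>n. qpoch_inf (f n) q) \<longlongrightarrow> 1) F"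
proof -
  define g where "g x = exp (norm x / (1 - norm q)) - 1" for x :: complex
  have "isCont g 0"
    unfolding g_def using assms(1) by (intro continuous_intros) auto
  then have "((\<lambda>n. g (f n)) \<longlongrightarrow> g 0) F"
    using assms(2) by (rule isCont_tendsto_compose)
  then have "((\<lambda>n. g (f n)) \<longlongrightarrow> 0) F"
    by (simp add: g_def)
  moreover have "\<forall>\<^sub>F n in F. norm (qpoch_inf (f n) q - 1) \<le> g (f n)"
    unfolding g_def by (intro always_eventually allI norm_qpoch_inf_minus_one_le assms(1))
  ultimately have "((\<lambda>n. qpoch_inf (f n) q - 1) \<longlongrightarrow> 0) F"
    by (rule Lim_null_comparison[rotated])
  then show ?thesis
    by (rule LIM_zero_cancel)
qed

text \<open>Split a product of \<open>m + n\<close> factors and let \<open>m\<close> tend to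
  infinity. With \<open>n = 1\<close> this compares the weights at \<open>A\<close> and
  \<open>A * p ^ 3\<close>; with \<open>n = k\<close> it recovers the finite denominators of the
  final sum.\<close>

lemma qpoch_inf_split:
  assumes "norm q < 1"
  shows "qpoch_inf x q = qpoch x q n * qpoch_inf (x * q ^ n) q"
proof -
  have "qpoch x q (m + n) = qpoch x q n * qpoch (x * q ^ n) q m" for m
    by (induction m) (simp_all add: qpoch_Suc power_add mult_ac)
  moreover have "(\<lambda>m. qpoch x q (m + n)) \<longlonglongrightarrow> qpoch_inf x q"
    using qpoch_tendsto[OF assms] by (rule LIMSEQ_ignore_initial_segment)
  moreover have "(\<lambda>m. qpoch x q n * qpoch (x * q ^ n) q m) \<longlonglongrightarrow> qpoch x q n * qpoch_inf (x * q ^ n) q"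
    by (intro tendsto_intros qpoch_tendsto assms)
  ultimately show ?thesis
    by (simp add: LIMSEQ_unique)
qed

text \<open>In the sense of \<open>convergent_prod\<close>, a product vanishes only if one of its
  factors does, and factor \<open>i\<close> divides \<open>qpoch x q (Suc i)\<close>.\<close>

lemma qpoch_inf_nonzero:
  assumes "norm q < 1" and "\<And>k. qpoch x q k \<noteq> 0"
  shows "qpoch_inf x q \<noteq> 0"
  unfolding qpoch_inf_def
proof (rule prodinf_nonzero[OF convergent_prod_qpoch[OF assms(1)]])
  show "1 - x * q ^ i \<noteq> 0" for i
    using assms(2)[of "Suc i"] by (simp add: qpoch_Suc)
qed

lemma qpoch_nonzero:
  assumes "norm q < 1" and "norm x < 1"
  shows "qpoch x q k \<noteq> 0"
proof -
  have "x * q ^ j \<noteq> 1" for j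
  proof
    assume "x * q ^ j = 1"
    then have "norm x * norm q ^ j = 1"
      by (metis norm_mult norm_one norm_power)
    moreover have "norm x * norm q ^ j \<le> norm x"
      using assms by (simp add: mult_left_le power_le_one)
    ultimately show False
      using assms by simp
  qed
  then show ?thesis
    by (simp add: qpoch_def)
qed

section \<open>The summand with a free parameter and its telescoping relation\<close>

text \<open>The last two factors are what remains of the infinite products with arguments
  \<open>A * b * p ^ 2\<close> and \<open>A * p ^ 3 / b\<close> and base \<open>p ^ 3\<close> after
  division by their first \<open>k\<close> factors. In this form no denominator depends on
  \<open>A\<close>.\<close>

definition cubic_weight :: "complex \<Rightarrow> complex \<Rightarrow> complex \<Rightarrow> nat \<Rightarrow> complex" where
  "cubic_weight p b A k = qpoch b p k * qpoch (p / b) p k / qpoch p p (2 * k) * p ^ (k\<^sup>2)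
     * qpoch_inf (A * b * p ^ (3 * k + 2)) (p ^ 3) * qpoch_inf (A * p ^ (3 * k + 3) / b) (p ^ 3)"

text \<open>The case distinction removes the singularity at \<open>A = 1\<close> of
  \<open>(1 - A p\<^bsup>4k\<^esup>) / (1 - A) (A; p)\<^bsub>2k\<^esub>\<close>.\<close>

definition cubic_term :: "complex \<Rightarrow> complex \<Rightarrow> complex \<Rightarrow> nat \<Rightarrow> complex" where
  "cubic_term p b A k =
     (if k = 0 then 1 else (1 - A * p ^ (4 * k)) * qpoch (A * p) p (2 * k - 1)) * cubic_weight p b A k"

text \<open>At \<open>k = 0\<close> the subtraction \<open>2k - 2\<close> truncates, but the factor \<open>1 - p\<^bsup>2k\<^esup>\<close> vanishes there.\<close>

definition cubic_cert :: "complex \<Rightarrow> complex \<Rightarrow> complex \<Rightarrow> nat \<Rightarrow> complex" where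
  "cubic_cert p b A k =
     A * (1 - p ^ (2 * k)) * (p - p ^ (2 * k)) * qpoch (A * p\<^sup>2) p (2 * k - 2) * cubic_weight p b A k"

text \<open>This is the telescoping relation for \<open>k > 0\<close> with \<open>y = p ^ k\<close>,
  after removal of the factors common to all terms. Replacing \<open>1 / b\<close> by
  \<open>c\<close> makes it a polynomial identity modulo \<open>b * c = 1\<close>.\<close>

lemma telescoping_polynomial:
  fixes A b p y :: complex
  assumes "b \<noteq> 0"
  shows "(1 - A * y ^ 4) * (1 - A * p) * (1 - A * b * p\<^sup>2 * y ^ 3) * (1 - A * p ^ 3 * y ^ 3 / b)
     - (1 - A * p ^ 3 * y ^ 4) * (1 - A * y\<^sup>2) * (1 - A * p * y\<^sup>2) * (1 - A * p\<^sup>2 * y\<^sup>2)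
   = A * p * (1 - b * y) * (1 - p * y / b) * (1 - A * y\<^sup>2) * (1 - A * p * y\<^sup>2) * (p * y\<^sup>2)
     - A * (1 - y\<^sup>2) * (p - y\<^sup>2) * (1 - A * b * p\<^sup>2 * y ^ 3) * (1 - A * p ^ 3 * y ^ 3 / b)"
proof -
  define c where "c = 1 / b"
  have "b * c = 1" using assms by (simp add: c_def)
  then have "(1 - A * y ^ 4) * (1 - A * p) * (1 - A * b * p\<^sup>2 * y ^ 3) * (1 - A * p ^ 3 * y ^ 3 * c)
     - (1 - A * p ^ 3 * y ^ 4) * (1 - A * y\<^sup>2) * (1 - A * p * y\<^sup>2) * (1 - A * p\<^sup>2 * y\<^sup>2)
   = A * p * (1 - b * y) * (1 - p * y * c) * (1 - A * y\<^sup>2) * (1 - A * p * y\<^sup>2) * (p * y\<^sup>2)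
     - A * (1 - y\<^sup>2) * (p - y\<^sup>2) * (1 - A * b * p\<^sup>2 * y ^ 3) * (1 - A * p ^ 3 * y ^ 3 * c)"
    by algebra
  then show ?thesis by (simp add: c_def)
qed

context
  fixes p b :: complex
  assumes p: "norm p < 1" and p0: "p \<noteq> 0" and b0: "b \<noteq> 0"
begin

lemma norm_p3: "norm (p ^ 3) < 1"
  using p by (simp add: norm_power power_less_one_iff)

text \<open>All four quantities reduce to \<open>W\<close>, the weight at \<open>A * p ^ 3\<close>,
  times finite products; for \<open>k > 0\<close> the rest is \<open>telescoping_polynomial\<close>.
  The case \<open>k = 0\<close> is separate because \<open>2 * k - 1\<close> and
  \<open>2 * k - 2\<close> truncate there.\<close>

lemma cubic_telescope:
  "cubic_term p b A k - (1 - A * p\<^sup>2) * (1 - A * p ^ 3) * cubic_term p b (A * p ^ 3) k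
     = cubic_cert p b A (Suc k) - cubic_cert p b A k"
proof -
  define y where "y = p ^ k"
  define W where "W = cubic_weight p b (A * p ^ 3) k"
  have y: "p ^ (2 * k) = y\<^sup>2" "p ^ (3 * k) = y ^ 3" "p ^ (4 * k) = y ^ 4"
    "p ^ (k * 2) = y\<^sup>2" "p ^ (k * 3) = y ^ 3" "p ^ (k * 4) = y ^ 4"
    by (simp_all add: y_def mult.commute flip: power_mult)
  \<comment> \<open>Going from \<open>A * p ^ 3\<close> back to \<open>A\<close> adds one leading
    factor to each infinite product.\<close>
  have W1: "cubic_weight p b A k = W * (1 - A * b * p\<^sup>2 * y ^ 3) * (1 - A * p ^ 3 * y ^ 3 / b)"
  proof -
    have "A * b * p ^ (3 * k + 2) = A * b * p\<^sup>2 * y ^ 3"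
      "A * p ^ (3 * k + 3) / b = A * p ^ 3 * y ^ 3 / b"
      "A * p ^ 3 * b * p ^ (3 * k + 2) = A * b * p\<^sup>2 * y ^ 3 * (p ^ 3) ^ 1"
      "A * p ^ 3 * p ^ (3 * k + 3) / b = A * p ^ 3 * y ^ 3 / b * (p ^ 3) ^ 1"
      by (simp_all add: power_add y_def eval_nat_numeral mult_ac)
    then show ?thesis
      unfolding W_def cubic_weight_def
      using qpoch_inf_split[OF norm_p3, of "A * b * p\<^sup>2 * y ^ 3" 1]
        qpoch_inf_split[OF norm_p3, of "A * p ^ 3 * y ^ 3 / b" 1]
      by (simp only: qpoch_Suc qpoch_0 One_nat_def power_0 mult_1 mult_1_right) (simp only: mult_ac)
  qed
  have nz: "1 - p * y\<^sup>2 \<noteq> 0" "1 - p\<^sup>2 * y\<^sup>2 \<noteq> 0"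
    using qpoch_nonzero[OF p p, of "2 * k + 2"] by (auto simp: qpoch_Suc y power2_eq_square mult_ac)
  have sq: "p ^ (Suc k)\<^sup>2 = p ^ k\<^sup>2 * (p * y\<^sup>2)"
    by (simp add: power2_eq_square y_def power_add mult_ac)
  \<comment> \<open>The infinite products at \<open>A\<close>, \<open>Suc k\<close> are those at
    \<open>A * p ^ 3\<close>, \<open>k\<close>. Only the finite factors change.\<close>
  have W2: "cubic_weight p b A (Suc k) * ((1 - p * y\<^sup>2) * (1 - p\<^sup>2 * y\<^sup>2))
      = W * (1 - b * y) * (1 - p * y / b) * (p * y\<^sup>2)"
  proof -
    have e: "A * b * p ^ (3 * Suc k + 2) = A * p ^ 3 * b * p ^ (3 * k + 2)"
      "A * p ^ (3 * Suc k + 3) / b = A * p ^ 3 * p ^ (3 * k + 3) / b"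
      by (simp_all add: power_add eval_nat_numeral mult_ac)
    have f: "qpoch p p (2 * Suc k) = qpoch p p (2 * k) * ((1 - p * y\<^sup>2) * (1 - p\<^sup>2 * y\<^sup>2))"
      by (simp add: qpoch_Suc y power2_eq_square mult_ac)
    show ?thesis
      unfolding cubic_weight_def W_def e f sq
      using nz by (simp add: qpoch_Suc y_def[symmetric] mult_ac)
  qed
  \<comment> \<open>At \<open>Suc k\<close> the factors \<open>1 - p ^ (2 * k)\<close> and
    \<open>p - p ^ (2 * k)\<close> of the certificate become, up to a factor \<open>p\<close>, the
    two new factors of the denominator, and cancel them.\<close>
  have c1: "cubic_cert p b A (Suc k)
     = A * p * qpoch (A * p\<^sup>2) p (2 * k) * (W * (1 - b * y) * (1 - p * y / b) * (p * y\<^sup>2))"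
  proof -
    have "p ^ (2 * Suc k) = p\<^sup>2 * y\<^sup>2" "p - p\<^sup>2 * y\<^sup>2 = p * (1 - p * y\<^sup>2)"
      by (simp_all add: y power2_eq_square algebra_simps)
    then show ?thesis
      unfolding W2[symmetric] cubic_cert_def by (simp only: mult_ac) simp
  qed
  show ?thesis
  proof (cases k)
    case 0
    then have "y = 1" by (simp add: y_def)
    have "cubic_term p b A k = W * ((1 - A * b * p\<^sup>2) * (1 - A * p ^ 3 / b))"
      "cubic_term p b (A * p ^ 3) k = W"
      unfolding cubic_term_def W1 W_def using 0 by (simp_all add: \<open>y = 1\<close>)
    then have "cubic_term p b A k - (1 - A * p\<^sup>2) * (1 - A * p ^ 3) * cubic_term p b (A * p ^ 3) k
       = W * ((1 - A * b * p\<^sup>2) * (1 - A * p ^ 3 / b) - (1 - A * p\<^sup>2) * (1 - A * p ^ 3))"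
      unfolding right_diff_distrib[of W] by (simp only: mult_ac)
    also have "(1 - A * b * p\<^sup>2) * (1 - A * p ^ 3 / b) - (1 - A * p\<^sup>2) * (1 - A * p ^ 3)
       = A * p * ((1 - b) * (1 - p / b) * p)"
      using b0 by (simp add: field_simps power2_eq_square power3_eq_cube)
    also have "W * (A * p * ((1 - b) * (1 - p / b) * p)) = cubic_cert p b A (Suc k) - cubic_cert p b A k"
      unfolding c1 using 0 by (simp add: \<open>y = 1\<close> cubic_cert_def)
    finally show ?thesis .
  next
    case (Suc m)
    \<comment> \<open>This is the Pochhammer factor of length \<open>2 * k - 2\<close> common to all
      terms.\<close>
    define Q where "Q = qpoch (A * p\<^sup>2) p (2 * m)"
    have pm: "p ^ (2 * m) * p\<^sup>2 = y\<^sup>2"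
      unfolding y(1)[symmetric] Suc by (simp add: power2_eq_square mult_ac)
    have q1: "qpoch (A * p) p (2 * k - 1) = (1 - A * p) * Q"
      using qpoch_Suc_shift[of "A * p" p "2 * m"] by (simp add: Suc Q_def power2_eq_square mult.assoc)
    have q2: "qpoch (A * p\<^sup>2) p (2 * k) = Q * (1 - A * y\<^sup>2) * (1 - A * p * y\<^sup>2)"
      unfolding pm[symmetric] by (simp add: Suc Q_def qpoch_Suc mult_ac)
    \<comment> \<open>The multiplier of the functional equation supplies the two leading factors
      that complete this to a product starting at \<open>A * p ^ 2\<close>.\<close>
    have q3: "(1 - A * p\<^sup>2) * (1 - A * p ^ 3) * qpoch (A * p ^ 3 * p) p (2 * k - 1)
       = Q * (1 - A * y\<^sup>2) * (1 - A * p * y\<^sup>2) * (1 - A * p\<^sup>2 * y\<^sup>2)"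
    proof -
      have "(1 - A * p\<^sup>2) * (1 - A * p ^ 3) * qpoch (A * p ^ 3 * p) p (2 * k - 1)
          = qpoch (A * p\<^sup>2) p (Suc (Suc (2 * k - 1)))"
        unfolding qpoch_Suc_shift by (simp add: power2_eq_square power3_eq_cube mult.assoc)
      also have "Suc (Suc (2 * k - 1)) = Suc (2 * k)"
        by (simp add: Suc)
      finally show ?thesis
        by (simp add: qpoch_Suc q2 y mult.assoc)
    qed
    have "cubic_term p b A k - (1 - A * p\<^sup>2) * (1 - A * p ^ 3) * cubic_term p b (A * p ^ 3) k
       = (1 - A * y ^ 4) * ((1 - A * p) * Q) * cubic_weight p b A k
         - (1 - A * p ^ 3 * y ^ 4) * ((1 - A * p\<^sup>2) * (1 - A * p ^ 3) * qpoch (A * p ^ 3 * p) p (2 * k - 1)) * W"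
      unfolding cubic_term_def q1 y W_def using Suc by simp
    also have "\<dots> = W * Q *
       ((1 - A * y ^ 4) * (1 - A * p) * (1 - A * b * p\<^sup>2 * y ^ 3) * (1 - A * p ^ 3 * y ^ 3 / b)
        - (1 - A * p ^ 3 * y ^ 4) * (1 - A * y\<^sup>2) * (1 - A * p * y\<^sup>2) * (1 - A * p\<^sup>2 * y\<^sup>2))"
      unfolding q3 W1 right_diff_distrib[of "W * Q"] by (simp only: mult_ac)
    also have "\<dots> = W * Q *
       (A * p * (1 - b * y) * (1 - p * y / b) * (1 - A * y\<^sup>2) * (1 - A * p * y\<^sup>2) * (p * y\<^sup>2)
        - A * (1 - y\<^sup>2) * (p - y\<^sup>2) * (1 - A * b * p\<^sup>2 * y ^ 3) * (1 - A * p ^ 3 * y ^ 3 / b))"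
      unfolding telescoping_polynomial[OF b0] ..
    also have "\<dots> = cubic_cert p b A (Suc k) - cubic_cert p b A k"
    proof -
      have "cubic_cert p b A k = A * (1 - y\<^sup>2) * (p - y\<^sup>2) * Q
          * (W * (1 - A * b * p\<^sup>2 * y ^ 3) * (1 - A * p ^ 3 * y ^ 3 / b))"
        unfolding cubic_cert_def W1 y by (simp add: Q_def Suc)
      then show ?thesis
        unfolding c1 q2 right_diff_distrib[of "W * Q"] by (simp only: mult_ac)
    qed
    finally show ?thesis .
  qed
qed

section \<open>Geometric bounds, summability and decay of the certificate\<close>

text \<open>Since \<open>k ^ 2\<close> is at least \<open>k\<close>, the power of \<open>p\<close>
  gives the geometric decay; all other factors are bounded. Uniformity over the disc of radius
  \<open>R\<close> is what dominated convergence in \<open>A\<close> requires.\<close>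

lemma cubic_weight_bound:
  "\<exists>C\<ge>0. \<forall>A k. norm A \<le> R \<longrightarrow> norm (cubic_weight p b A k) \<le> C * norm p ^ k"
proof (cases "R \<ge> 0")
  case False
  then have "\<not> norm A \<le> R" for A :: complex
    using norm_ge_zero[of A] by linarith
  then show ?thesis by auto
next
  case True
  define E where "E x = exp (x / (1 - norm (p ^ 3)))" for x
  note p3 = norm_p3
  \<comment> \<open>The reciprocals converge because the limit of the denominators is nonzero, hence
    they are bounded.\<close>
  obtain D where D: "D > 0" "\<And>k. norm (inverse (qpoch p p k)) \<le> D"
  proof -
    have "qpoch_inf p p \<noteq> 0"
      using qpoch_inf_nonzero[OF p qpoch_nonzero[OF p p]] .
    then have "(\<lambda>k. inverse (qpoch p p k)) \<longlonglongrightarrow> inverse (qpoch_inf p p)"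
      by (intro tendsto_inverse qpoch_tendsto p)
    then have "Bseq (\<lambda>k. inverse (qpoch p p k))"
      by (intro convergent_imp_Bseq convergentI)
    then show ?thesis
      using that by (auto elim: BseqE)
  qed
  have P: "norm (qpoch_inf (A * c) (p ^ 3)) \<le> E (R * norm d)"
    if "norm A \<le> R" "norm c \<le> norm d" for A c d
  proof -
    have "norm (A * c) \<le> R * norm d"
      unfolding norm_mult using that True by (intro mult_mono) auto
    then have "norm (A * c) / (1 - norm (p ^ 3)) \<le> R * norm d / (1 - norm (p ^ 3))"
      using p3 by (intro divide_right_mono) auto
    then show ?thesis
      unfolding E_def using norm_qpoch_inf_le[OF p3, of "A * c"] by (meson exp_le_cancel_iff order_trans)
  qed
  have pow: "norm (p ^ n) \<le> 1" for n
    using p by (simp add: norm_power power_le_one)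
  define C where "C = exp (norm b / (1 - norm p)) * exp (norm (p / b) / (1 - norm p)) * D
    * E (R * norm b) * E (R * norm (1 / b))"
  have "norm (cubic_weight p b A k) \<le> C * norm p ^ k" if A: "norm A \<le> R" for A k
  proof -
    have "norm (cubic_weight p b A k) = norm (qpoch b p k) * norm (qpoch (p / b) p k)
       * norm (inverse (qpoch p p (2 * k))) * norm (p ^ k\<^sup>2)
       * norm (qpoch_inf (A * (b * p ^ (3 * k + 2))) (p ^ 3))
       * norm (qpoch_inf (A * (p ^ (3 * k + 3) / b)) (p ^ 3))"
      by (simp add: cubic_weight_def norm_mult norm_divide norm_inverse divide_inverse mult.assoc)
    also have "\<dots> \<le> exp (norm b / (1 - norm p)) * exp (norm (p / b) / (1 - norm p)) * D
        * norm p ^ k * E (R * norm b) * E (R * norm (1 / b))"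
    proof (intro mult_mono mult_nonneg_nonneg norm_ge_zero norm_qpoch_le p D P A)
      show "norm (p ^ k\<^sup>2) \<le> norm p ^ k"
        unfolding norm_power using p by (intro power_decreasing) (auto simp: power2_eq_square)
      show "norm (b * p ^ (3 * k + 2)) \<le> norm b"
        using pow[of "3 * k + 2"] by (simp only: norm_mult mult_left_le norm_ge_zero)
      show "norm (p ^ (3 * k + 3) / b) \<le> norm (1 / b)"
        using pow[of "3 * k + 3"] by (simp only: norm_divide norm_one divide_right_mono norm_ge_zero)
    qed (use D in \<open>auto simp: E_def\<close>)
    finally show ?thesis
      by (simp only: C_def mult_ac)
  qed
  moreover have "C \<ge> 0"
    using D by (simp add: C_def E_def)
  ultimately show ?thesis by blast
qed

lemma norm_qpoch_le_uniform:
  assumes "norm A \<le> R"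
  shows "norm (qpoch (A * p ^ i) p n) \<le> exp (R / (1 - norm p))"
proof -
  have "norm (A * p ^ i) \<le> norm A"
    using p by (simp add: norm_mult norm_power mult_left_le power_le_one)
  then have "norm (A * p ^ i) / (1 - norm p) \<le> R / (1 - norm p)"
    using p assms by (intro divide_right_mono) auto
  then show ?thesis
    using norm_qpoch_le[OF p, of "A * p ^ i" n] by (meson exp_le_cancel_iff order_trans)
qed

lemma cubic_term_bound:
  "\<exists>C. \<forall>A k. norm A \<le> R \<longrightarrow> norm (cubic_term p b A k) \<le> C * norm p ^ k"
proof -
  obtain C where C: "C \<ge> 0" "\<And>A k. norm A \<le> R \<Longrightarrow> norm (cubic_weight p b A k) \<le> C * norm p ^ k"
    using cubic_weight_bound by blast
  define F where "F = (1 + R) * exp (R / (1 - norm p))"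
  have "norm (cubic_term p b A k) \<le> (1 + F) * C * norm p ^ k" if A: "norm A \<le> R" for A k
  proof -
    have R: "R \<ge> 0"
      using A norm_ge_zero[of A] by linarith
    then have F: "F \<ge> 0" by (simp add: F_def)
    have "norm (A * p ^ (4 * k)) \<le> norm A"
      using p by (simp add: norm_mult norm_power mult_left_le power_le_one)
    then have "norm (1 - A * p ^ (4 * k)) \<le> 1 + R"
      using norm_triangle_ineq4[of 1 "A * p ^ (4 * k)"] A by simp
    then have "norm ((1 - A * p ^ (4 * k)) * qpoch (A * p ^ 1) p (2 * k - 1)) \<le> F"
      unfolding F_def norm_mult using R by (intro mult_mono norm_qpoch_le_uniform A) auto
    \<comment> \<open>\<open>1 + F\<close> covers both branches: 1 at \<open>k = 0\<close> and
      \<open>F\<close> elsewhere.\<close>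
    then have "norm (if k = 0 then 1 else (1 - A * p ^ (4 * k)) * qpoch (A * p) p (2 * k - 1)) \<le> 1 + F"
      using F by auto
    then have "norm (cubic_term p b A k) \<le> (1 + F) * (C * norm p ^ k)"
      unfolding cubic_term_def norm_mult using F by (intro mult_mono C A) auto
    then show ?thesis by (simp only: mult_ac)
  qed
  then show ?thesis by blast
qed

lemma summable_cubic_term: "summable (cubic_term p b A)"
proof -
  obtain C where "\<And>k. norm (cubic_term p b A k) \<le> C * norm p ^ k"
    using cubic_term_bound[of "norm A"] by blast
  moreover have "summable (\<lambda>k. C * norm p ^ k)"
    using p by (intro summable_mult summable_geometric) auto
  ultimately show ?thesis
    by (rule summable_comparison_test'[rotated])
qed

lemma cubic_cert_tendsto: "cubic_cert p b A \<longlonglongrightarrow> 0"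
proof -
  obtain C where C: "C \<ge> 0" "\<And>k. norm (cubic_weight p b A k) \<le> C * norm p ^ k"
    using cubic_weight_bound[of "norm A"] by blast
  define F where "F = norm A * 2 * 2 * exp (norm A / (1 - norm p))"
  have pow: "norm (p ^ n) \<le> 1" for n
    using p by (simp add: norm_power power_le_one)
  have "norm (cubic_cert p b A k) \<le> F * C * norm p ^ k" for k
  proof -
    have "norm (1 - p ^ (2 * k)) \<le> 2" "norm (p - p ^ (2 * k)) \<le> 2"
      using norm_triangle_ineq4[of 1 "p ^ (2 * k)"] norm_triangle_ineq4[of p "p ^ (2 * k)"]
        pow[of "2 * k"] p unfolding norm_one by linarith+
    then have "norm (cubic_cert p b A k) \<le> F * (C * norm p ^ k)"
      unfolding cubic_cert_def F_def norm_mult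
      by (intro mult_mono norm_qpoch_le_uniform C) auto
    then show ?thesis by (simp only: mult_ac)
  qed
  then have "\<forall>\<^sub>F k in sequentially. norm (cubic_cert p b A k) \<le> F * C * norm p ^ k"
    by (rule eventuallyI)
  moreover have "(\<lambda>k. F * C * norm p ^ k) \<longlonglongrightarrow> 0"
    using p by (intro tendsto_mult_right_zero LIMSEQ_power_zero) simp
  ultimately show ?thesis
    by (rule Lim_null_comparison)
qed

section \<open>The functional equation in \<open>A\<close> and its solution\<close>

lemma cubic_sum_step:
  "suminf (cubic_term p b A) = (1 - A * p\<^sup>2) * (1 - A * p ^ 3) * suminf (cubic_term p b (A * p ^ 3))"
proof -
  \<comment> \<open>Both boundary terms vanish: the certificate tends to 0, and at
    \<open>k = 0\<close> it contains \<open>1 - p ^ 0\<close>.\<close>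
  have "(\<lambda>k. cubic_cert p b A (Suc k) - cubic_cert p b A k) sums (0 - cubic_cert p b A 0)"
    by (intro telescope_sums cubic_cert_tendsto)
  then have "(\<lambda>k. cubic_cert p b A (Suc k) - cubic_cert p b A k) sums 0"
    by (simp add: cubic_cert_def)
  moreover have "(\<lambda>k. cubic_term p b A k - (1 - A * p\<^sup>2) * (1 - A * p ^ 3) * cubic_term p b (A * p ^ 3) k)
     sums (suminf (cubic_term p b A) - (1 - A * p\<^sup>2) * (1 - A * p ^ 3) * suminf (cubic_term p b (A * p ^ 3)))"
    by (intro sums_diff sums_mult summable_sums summable_cubic_term)
  ultimately have "suminf (cubic_term p b A)
     - (1 - A * p\<^sup>2) * (1 - A * p ^ 3) * suminf (cubic_term p b (A * p ^ 3)) = 0"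
    unfolding cubic_telescope by (rule sums_unique2[rotated])
  then show ?thesis by simp
qed

lemma cubic_sum_iterate:
  "suminf (cubic_term p b A) = qpoch (A * p\<^sup>2) (p ^ 3) n * qpoch (A * p ^ 3) (p ^ 3) n
     * suminf (cubic_term p b (A * (p ^ 3) ^ n))"
proof (induction n)
  case (Suc n)
  show ?case
    unfolding Suc cubic_sum_step[of "A * (p ^ 3) ^ n"] qpoch_Suc power_Suc2
    by (simp only: mult_ac)
qed simp

lemma cubic_term_tendsto:
  assumes "f \<longlonglongrightarrow> 0"
  shows "(\<lambda>n. cubic_term p b (f n) k) \<longlonglongrightarrow> cubic_term p b 0 k"
proof -
  have *: "(\<lambda>n. qpoch_inf (f n * c) (p ^ 3)) \<longlonglongrightarrow> qpoch_inf (0 * c) (p ^ 3)" for c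
    using qpoch_inf_tendsto_one[OF norm_p3 tendsto_mult_left_zero[OF assms]] by simp
  have "(\<lambda>n. cubic_weight p b (f n) k) \<longlonglongrightarrow> cubic_weight p b 0 k"
    unfolding cubic_weight_def times_divide_eq_right[symmetric] mult.assoc
    by (intro tendsto_mult tendsto_const *)
  moreover have "(\<lambda>n. if k = 0 then 1 else (1 - f n * p ^ (4 * k)) * qpoch (f n * p) p (2 * k - 1))
     \<longlonglongrightarrow> (if k = 0 then 1 else (1 - 0 * p ^ (4 * k)) * qpoch (0 * p) p (2 * k - 1))"
    unfolding qpoch_def using assms
    by (cases "k = 0"; simp only: if_True if_False refl; intro tendsto_intros)
  ultimately show ?thesis
    unfolding cubic_term_def by (rule tendsto_mult[rotated])
qed

text \<open>Tannery's theorem applies: each term converges, and all parameters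
  \<open>A * (p ^ 3) ^ n\<close> lie in the disc of radius \<open>norm A\<close>, so one geometric
  majorant serves for every \<open>n\<close>.\<close>

lemma cubic_sum_tendsto:
  "(\<lambda>n. suminf (cubic_term p b (A * (p ^ 3) ^ n))) \<longlonglongrightarrow> suminf (cubic_term p b 0)"
proof -
  note p3 = norm_p3
  obtain C where C: "\<And>B k. norm B \<le> norm A \<Longrightarrow> norm (cubic_term p b B k) \<le> C * norm p ^ k"
    using cubic_term_bound by blast
  have "norm (A * (p ^ 3) ^ n) \<le> norm A" for n
    using p3 unfolding norm_mult norm_power[of "p ^ 3"] by (intro mult_left_le power_le_one) auto
  then have bd: "norm (cubic_term p b (A * (p ^ 3) ^ n) k) \<le> C * norm p ^ k" for n k
    by (rule C)
  have "(\<lambda>n. A * (p ^ 3) ^ n) \<longlonglongrightarrow> 0"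
    using p3 by (intro tendsto_mult_right_zero LIMSEQ_power_zero)
  then have "\<And>k. (\<lambda>n. cubic_term p b (A * (p ^ 3) ^ n) k) \<longlonglongrightarrow> cubic_term p b 0 k"
    by (rule cubic_term_tendsto)
  moreover have "summable (\<lambda>k. C * norm p ^ k)"
    using p by (intro summable_mult summable_geometric) auto
  ultimately show ?thesis
    using tannerys_theorem[of "\<lambda>k n. cubic_term p b (A * (p ^ 3) ^ n) k" "cubic_term p b 0"
        sequentially "\<lambda>k. C * norm p ^ k"] bd
    by (simp add: case_prod_beta always_eventually)
qed

lemma cubic_sum_eq_sum_0:
  "suminf (cubic_term p b A) = qpoch_inf (A * p\<^sup>2) (p ^ 3) * qpoch_inf (A * p ^ 3) (p ^ 3)
     * suminf (cubic_term p b 0)"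
proof -
  have "(\<lambda>n. qpoch (A * p\<^sup>2) (p ^ 3) n * qpoch (A * p ^ 3) (p ^ 3) n
      * suminf (cubic_term p b (A * (p ^ 3) ^ n)))
    \<longlonglongrightarrow> qpoch_inf (A * p\<^sup>2) (p ^ 3) * qpoch_inf (A * p ^ 3) (p ^ 3) * suminf (cubic_term p b 0)"
    by (intro tendsto_mult cubic_sum_tendsto qpoch_tendsto norm_p3)
  then show ?thesis
    \<comment> \<open>Read backwards, the iteration makes the sequence constant in \<open>n\<close>,
      so its value equals the limit.\<close>
    unfolding cubic_sum_iterate[symmetric] by (simp add: LIMSEQ_const_iff)
qed

theorem cubic_summation:
  "cubic_term p b A sums
     (qpoch_inf (A * p\<^sup>2) (p ^ 3) * qpoch_inf (A * p ^ 3) (p ^ 3)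
      * qpoch_inf (b * p) (p ^ 3) * qpoch_inf (p\<^sup>2 / b) (p ^ 3)
      / (qpoch_inf p (p ^ 3) * qpoch_inf (p\<^sup>2) (p ^ 3)))"
proof -
  note p3 = norm_p3
  \<comment> \<open>For \<open>k > 0\<close> the product of length \<open>2 * k - 1\<close> is
    nonempty and starts with \<open>1 - A * p\<close>, which is 0 at
    \<open>A = 1 / p\<close>.\<close>
  have "cubic_term p b (1 / p) k = (if k = 0 then cubic_weight p b (1 / p) 0 else 0)" for k
  proof (cases k)
    case (Suc m)
    then have "2 * k - 1 = Suc (2 * m)" by simp
    then show ?thesis
      using p0 by (simp add: cubic_term_def Suc qpoch_Suc_shift)
  qed (simp add: cubic_term_def)
  then have "cubic_term p b (1 / p) sums (\<Sum>k\<in>{0}. cubic_term p b (1 / p) k)"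
    by (intro sums_finite) auto
  then have "cubic_term p b (1 / p) sums cubic_weight p b (1 / p) 0"
    by (simp add: cubic_term_def)
  moreover have "cubic_weight p b (1 / p) 0 = qpoch_inf (b * p) (p ^ 3) * qpoch_inf (p\<^sup>2 / b) (p ^ 3)"
    using p0 by (simp add: cubic_weight_def power2_eq_square power3_eq_cube)
  ultimately have "qpoch_inf (b * p) (p ^ 3) * qpoch_inf (p\<^sup>2 / b) (p ^ 3)
     = suminf (cubic_term p b (1 / p))"
    by (simp add: sums_iff)
  also have "\<dots> = qpoch_inf p (p ^ 3) * qpoch_inf (p\<^sup>2) (p ^ 3) * suminf (cubic_term p b 0)"
    using p0 by (subst cubic_sum_eq_sum_0) (simp add: power2_eq_square power3_eq_cube)
  finally have "qpoch_inf (b * p) (p ^ 3) * qpoch_inf (p\<^sup>2 / b) (p ^ 3)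
     = qpoch_inf p (p ^ 3) * qpoch_inf (p\<^sup>2) (p ^ 3) * suminf (cubic_term p b 0)" .
  moreover have "qpoch_inf p (p ^ 3) \<noteq> 0" "qpoch_inf (p\<^sup>2) (p ^ 3) \<noteq> 0"
    using p by (auto intro!: qpoch_inf_nonzero[OF p3] qpoch_nonzero[OF p3]
        simp: norm_power power_less_one_iff)
  ultimately have "suminf (cubic_term p b 0) = qpoch_inf (b * p) (p ^ 3) * qpoch_inf (p\<^sup>2 / b) (p ^ 3)
      / (qpoch_inf p (p ^ 3) * qpoch_inf (p\<^sup>2) (p ^ 3))"
    by (simp add: field_simps)
  then show ?thesis
    using summable_sums[OF summable_cubic_term, of A] unfolding cubic_sum_eq_sum_0[of A]
    by (simp add: mult.assoc)
qed

end

section \<open>Specialization to \<open>p = q ^ 2\<close>, \<open>b = a * q\<close>,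
  \<open>A = q\<close>\<close>

theorem theorem6:
  fixes q a :: complex
  assumes "norm q < 1" and "a \<noteq> 0"
    and "\<And>k. qpoch (a * q ^ 6) (q ^ 6) k \<noteq> 0"
    and "\<And>k. qpoch (q ^ 6 / a) (q ^ 6) k \<noteq> 0"
  shows "(\<lambda>k. (qpoch (a * q) (q\<^sup>2) k * qpoch (q / a) (q\<^sup>2) k * qpoch q (q\<^sup>2) (2 * k)) /
              (qpoch (q\<^sup>2) (q\<^sup>2) (2 * k) * qpoch (a * q ^ 6) (q ^ 6) k * qpoch (q ^ 6 / a) (q ^ 6) k)
              * qint q (8 * k + 1) * q ^ (2 * k\<^sup>2))
         sums
           ((qpoch_inf (q ^ 5) (q ^ 6) * qpoch_inf (q ^ 7) (q ^ 6) *
             qpoch_inf (a * q ^ 3) (q ^ 6) * qpoch_inf (q ^ 3 / a) (q ^ 6)) /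
            (qpoch_inf (q\<^sup>2) (q ^ 6) * qpoch_inf (q ^ 4) (q ^ 6) *
             qpoch_inf (a * q ^ 6) (q ^ 6) * qpoch_inf (q ^ 6 / a) (q ^ 6)))"
\<comment> \<open>The general summation takes \<open>p\<close> and \<open>b\<close> nonzero. At
  \<open>q = 0\<close> only the term \<open>k = 0\<close> survives, and both sides are 1.\<close>
proof (cases "q = 0")
  case True
  show ?thesis (is "?f sums ?s")
  proof -
    have "?f sums (\<Sum>k\<in>{0}. ?f k)"
      using True by (intro sums_finite) auto
    then show ?thesis
      using True by (simp add: qint_def)
  qed
next
  case False
  define p where "p = q\<^sup>2"
  define b where "b = a * q"
  have p: "norm p < 1" "p \<noteq> 0"
    using assms(1) False by (auto simp: p_def norm_power power_less_one_iff)
  have b: "b \<noteq> 0"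
    using False assms(2) by (simp add: b_def)
  have q6: "norm (q ^ 6) < 1"
    using assms(1) by (simp add: norm_power power_less_one_iff)
  have p3: "p ^ 3 = q ^ 6"
    by (simp add: p_def flip: power_mult)
  \<comment> \<open>This is the normalizing factor by which the original sum was multiplied; the
    hypotheses on the denominators make it nonzero.\<close>
  define D where "D = qpoch_inf (a * q ^ 6) (q ^ 6) * qpoch_inf (q ^ 6 / a) (q ^ 6)"
  have D: "D \<noteq> 0"
    using qpoch_inf_nonzero[OF q6] assms(3,4) by (simp add: D_def)
  have pb: "p / b = q / a"
    using False by (simp add: p_def b_def power2_eq_square)
  have terms: "cubic_term p b q k / D =
     (qpoch (a * q) (q\<^sup>2) k * qpoch (q / a) (q\<^sup>2) k * qpoch q (q\<^sup>2) (2 * k)) /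
       (qpoch (q\<^sup>2) (q\<^sup>2) (2 * k) * qpoch (a * q ^ 6) (q ^ 6) k * qpoch (q ^ 6 / a) (q ^ 6) k)
       * qint q (8 * k + 1) * q ^ (2 * k\<^sup>2)" for k
  proof -
    \<comment> \<open>The tails \<open>T1\<close> and \<open>T2\<close> of \<open>D\<close> are the
      infinite products in the weight, so dividing by \<open>D\<close> leaves exactly the two finite
      denominators.\<close>
    define T1 where "T1 = qpoch_inf (a * q ^ 6 * (q ^ 6) ^ k) (q ^ 6)"
    define T2 where "T2 = qpoch_inf (q ^ 6 / a * (q ^ 6) ^ k) (q ^ 6)"
    have D_eq: "D = qpoch (a * q ^ 6) (q ^ 6) k * T1 * (qpoch (q ^ 6 / a) (q ^ 6) k * T2)"
      unfolding D_def T1_def T2_def using qpoch_inf_split[OF q6, of _ k] by metis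
    have T: "T1 \<noteq> 0" "T2 \<noteq> 0"
      using D D_eq by auto
    have p3k: "p ^ (3 * k) = (q ^ 6) ^ k"
      by (simp add: power_mult p3)
    have args: "q * b * p ^ (3 * k + 2) = a * q ^ 6 * (q ^ 6) ^ k"
      "q * p ^ (3 * k + 3) / b = q ^ 6 / a * (q ^ 6) ^ k"
      unfolding power_add p3k p3 using False
      by (simp_all add: p_def b_def eval_nat_numeral)
    have pk: "p ^ k\<^sup>2 = q ^ (2 * k\<^sup>2)" "p ^ (4 * k) = q ^ (8 * k)"
      by (simp_all add: p_def flip: power_mult)
    have w: "cubic_weight p b q k = qpoch (a * q) p k * qpoch (q / a) p k / qpoch p p (2 * k)
        * q ^ (2 * k\<^sup>2) * T1 * T2"
      unfolding cubic_weight_def args pb p3 T1_def T2_def pk by (simp only: b_def)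
    have q1: "q \<noteq> 1"
      using assms(1) by auto
    \<comment> \<open>The factor \<open>1 - q\<close> in the denominator of \<open>qint\<close> is
      the first factor of \<open>qpoch q p (2 * k)\<close>; at \<open>k = 0\<close> both sides are
      1.\<close>
    have "(if k = 0 then 1 else (1 - q * p ^ (4 * k)) * qpoch (q * p) p (2 * k - 1))
      = qpoch q p (2 * k) * qint q (8 * k + 1)"
    proof (cases k)
      case 0
      then show ?thesis using q1 by (simp add: qint_def)
    next
      case (Suc m)
      then have "2 * k = Suc (2 * k - 1)" by simp
      then have "qpoch q p (2 * k) = (1 - q) * qpoch (q * p) p (2 * k - 1)"
        by (metis qpoch_Suc_shift)
      then show ?thesis
        using q1 Suc unfolding pk qint_def power_add by simp
    qed
    then have "cubic_term p b q k = qpoch q p (2 * k) * qint q (8 * k + 1) * cubic_weight p b q k"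
      by (simp only: cubic_term_def)
    then show ?thesis
      unfolding w D_eq using T by (simp add: p_def[symmetric] mult_ac)
  qed
  have "(\<lambda>k. cubic_term p b q k / D) sums
     (qpoch_inf (q * p\<^sup>2) (p ^ 3) * qpoch_inf (q * p ^ 3) (p ^ 3)
      * qpoch_inf (b * p) (p ^ 3) * qpoch_inf (p\<^sup>2 / b) (p ^ 3)
      / (qpoch_inf p (p ^ 3) * qpoch_inf (p\<^sup>2) (p ^ 3)) / D)"
    using cubic_summation[OF p b] by (rule sums_divide)
  moreover have "q * p\<^sup>2 = q ^ 5" "q * p ^ 3 = q ^ 7" "b * p = a * q ^ 3" "p\<^sup>2 / b = q ^ 3 / a" "p\<^sup>2 = q ^ 4"
    using False by (simp_all add: p_def b_def eval_nat_numeral)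
  ultimately show ?thesis
    unfolding terms p3 unfolding D_def by (simp add: p_def mult.assoc)
qed

end
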